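(* Let $\alpha=\{\alpha_t:t=0,\dots,T\}$ be a dynamic path dependent assessment index, $\alpha_t:\mathcal X^p_t\to\bar L^0(\mathscr F_t)$, satisfying the standing assumptions in the context, and let $$C_t(X):=\operatorname{ess\,inf}\{m_t\in L^p(\mathscr F_t):\alpha_t(X_{[0,t-1]}+m_t1_{[t,T]})\ge\alpha_t(X)\},\qquad X\in\mathcal X^p_t,\ t=0,\dots,T,$$ be the corresponding family of certainty equivalents. If $\alpha$ is strongly time consistent, then for each $t=0,\dots,T-1$, $$C_t(X)=C_t\big(X_{[0,t]}+C_{t+1}(X)1_{[t+1,T]}\big),\qquad X\in\mathcal X^p_t.$$
   Context: $(\Omega,\mathscr F,P)$ is a probability space with a filtration $(\mathscr F_s)_{s=0,\dots,T}$; $p\in[1,\infty]$. $L^0(\mathscr F_t)$, $\bar L^0(\mathscr F_t)$ are the a.s. classes of $\mathscr F_t$-measurable variables with values in $\mathbb R$, $[-\infty,\infty]$; (in)equalities are a.s.; $L^0_{++}(\mathscr F_t)$, $L^0_+(\mathscr F_t)$ are the a.s. strictly positive, resp. nonnegative, elements. $L^0(\mathscr O)$ is the set of adapted real processes $X=(X_s)_{s=0,\dots,T}$; $L^0(\mathscr O^{t-1})$ those constant from time $t-1$ on. $1_{[s,\tilde s]}$ is the process equal to $1$ at times in $[s,\tilde s]$ and $0$ otherwise, and $X_{[s,\tilde s]}=X1_{[s,\tilde s]}$ (for $t=0$, $X_{[0,t-1]}$ is void); $L^0(\mathscr O_{[t,T]})=\{X_{[t,T]}:X\in L^0(\mathscr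 O)\}$. $\mu$ is a measure on $\{t,\dots,T\}$ with $\mu_s>0$; $L^p(\mathscr O_{[t,T]})$ is taken with respect to $P\otimes\mu$; $L^{t,p}(\mathscr O_{[t,T]})=L^0(\mathscr F_t)L^p(\mathscr O_{[t,T]})$ is an $L^0(\mathscr F_t)$-module with the topology of the conditional norm $E_P[\sum_{k=t}^T|X_k|^p\mu_k\mid\mathscr F_t]^{1/p}$ (balls of radius $\varepsilon\in L^0_{++}(\mathscr F_t)$) if $p<\infty$, and for $p=\infty$ the conditional weak$^*$ topology generated by the neighborhoods of $0$ $\{X:|E_P[\sum_{k=t}^TX_k\Lambda_k\mu_k\mid\mathscr F_t]|\le\varepsilon\ \forall\Lambda\in\mathcal A\}$, $\mathcal A\subseteq L^{t,1}(\mathscr O_{[t,T]})$ finite. $\mathcal X^p_t=\{X\in L^0(\mathscr O):X_{[t,T]}\in L^{t,p}(\mathscr O_{[t,T]})\}$; $\mathcal X^p_t\subseteq\mathcal X^p_{t+1}$. $\alpha_t:\mathcal X^p_t\to\bar L^0(\mathscr F_t)$ is an upper semicontinuous path dependent assessment index if for every $\bar X\in L^0(\mathscr O^{t-1})$ the map $\beta:X_{[t,T]}\mapsto\alpha_t(\bar X_{[0,t-1]}+X_{[t,T]})$ on $L^{t,p}(\mathscr O_{[t,T]})$ is local ($\beta(1_AX+1_{A^c}Y)=1_A\beta(X)+1_{A^c}\beta(Y)$, $A\in\mathscr F_t$), quasiconcave ($\beta(\lambda X+(1-\lambda)Y)\ge\beta(X)\wedge\beta(Y)$, $\lambda\in L^0(\mathscr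 F_t)$, $0\le\lambda\le1$), monotone for the a.s. order, with closed upper level sets $\{\beta\ge m\}$, $m\in\bar L^0(\mathscr F_t)$. A dynamic path dependent assessment index is a family of such $\alpha_t$, $t=0,\dots,T$. Standing assumptions: for each $t$ and each past, $\alpha_t$ is an upper semicontinuous path dependent assessment index and, with $\kappa=1_{[t,T]}$, the map $\beta$ above is - bounded: for each $X$ there are $m_1,m_2\in L^p(\mathscr F_t)$ with $\beta(m_1\kappa)<\beta(X)\le\beta(m_2\kappa)$; - sensitive: if $m\in L^0(\mathscr F_t)$ and $\beta(m\kappa)>\beta(Y)$ on $A\in\mathscr F_t$, there is $\varepsilon\in L^0_+(\mathscr F_t)$, $\varepsilon>0$ on $A$, with $\beta((m-\varepsilon)\kappa)\ge\beta(Y)$ on $A$; - strictly increasing: $\beta(m\kappa)>\beta(m'\kappa)$ on $A$ whenever $m,m'\in L^0(\mathscr F_t)$, $m>m'$ on $A$. $\alpha$ is strongly time consistent if for all $t$ and all $X,Y\in\mathcal X^p_t$ with $X_{[0,t]}=Y_{[0,t]}$: $\alpha_{t+1}(X)\ge\alpha_{t+1}(Y)$ implies $\alpha_t(X)\ge\alpha_t(Y)$. *)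

theory Defs
  imports "HOL-Probability.Probability" "HOL-Library.Function_Algebras"
begin

text \<open>
  Random variables and processes are represented by functions rather than by almost sure classes:
  (in)equalities between them are stated with \<open>AE \<omega> in M\<close>, and operators on classes are required to
  respect almost sure equality. A process is a function \<open>nat \<Rightarrow> 'a \<Rightarrow> real\<close> of which only the times
  \<open>0, \<dots>, T\<close> matter. Sums, differences and products of processes are pointwise.
\<close>

definition Lp :: "'b measure \<Rightarrow> ennreal \<Rightarrow> ('b \<Rightarrow> real) set" where
  "Lp N q = {f \<in> borel_measurable N.
     if q = \<infinity> then \<exists>c. AE x in N. \<bar>f x\<bar> \<le> c
     else integrable N (\<lambda>x. \<bar>f x\<bar> powr enn2real q)}"

text \<open>
  The essential infimum of a family \<open>S\<close> of real random variables is its infimum in the lattice of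
  \<open>G\<close>-measurable extended real random variables, ordered almost surely. It is unique only up to
  almost sure equality; \<open>ess_inf\<close> picks a version.
\<close>

definition is_ess_inf ::
  "'a measure \<Rightarrow> 'a measure \<Rightarrow> ('a \<Rightarrow> real) set \<Rightarrow> ('a \<Rightarrow> ereal) \<Rightarrow> bool" where
  "is_ess_inf M G S Z \<longleftrightarrow>
     Z \<in> borel_measurable G \<and>
     (\<forall>m\<in>S. AE \<omega> in M. Z \<omega> \<le> ereal (m \<omega>)) \<and>
     (\<forall>W\<in>borel_measurable G. (\<forall>m\<in>S. AE \<omega> in M. W \<omega> \<le> ereal (m \<omega>)) \<longrightarrow> (AE \<omega> in M. W \<omega> \<le> Z \<omega>))"

definition ess_inf :: "'a measure \<Rightarrow> 'a measure \<Rightarrow> ('a \<Rightarrow> real) set \<Rightarrow> 'a \<Rightarrow> ereal" where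
  "ess_inf M G S = (SOME Z. is_ess_inf M G S Z)"

text \<open>
  \<open>on_times I X\<close> is the process \<open>X 1\<^sub>I\<close>. Thus \<open>X\<^bsub>[t,T]\<^esub>\<close> is \<open>on_times {t..T} X\<close>, and \<open>X\<^bsub>[0,t-1]\<^esub>\<close> is
  \<open>on_times {..<t} X\<close>, which is zero for \<open>t = 0\<close>.
\<close>

definition on_times :: "nat set \<Rightarrow> (nat \<Rightarrow> 'a \<Rightarrow> real) \<Rightarrow> nat \<Rightarrow> 'a \<Rightarrow> real" where
  "on_times I X = (\<lambda>k \<omega>. if k \<in> I then X k \<omega> else 0)"

abbreviation const_on :: "nat set \<Rightarrow> ('a \<Rightarrow> real) \<Rightarrow> nat \<Rightarrow> 'a \<Rightarrow> real" where
  "const_on I m \<equiv> on_times I (\<lambda>_. m)"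

text \<open>
  \<open>\<mu> t s\<close> is the mass of time \<open>s\<close> under the measure used on \<open>{t..T}\<close>; it may depend on \<open>t\<close>.
\<close>

locale filtered_setting = prob_space M
  for M :: "'a measure" and F :: "nat \<Rightarrow> 'a measure" and T :: nat
    and p :: ennreal and \<mu> :: "nat \<Rightarrow> nat \<Rightarrow> real" +
  assumes subalg: "\<And>s. s \<le> T \<Longrightarrow> subalgebra M (F s)"
    and filt: "\<And>s r. s \<le> r \<Longrightarrow> r \<le> T \<Longrightarrow> subalgebra (F r) (F s)"
    and p_ge_1: "1 \<le> p"
    and \<mu>_pos: "\<And>t s. t \<le> s \<Longrightarrow> s \<le> T \<Longrightarrow> 0 < \<mu> t s"
begin

definition LpF :: "nat \<Rightarrow> ('a \<Rightarrow> real) set" where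
  "LpF t = {m \<in> borel_measurable (F t). m \<in> Lp M p}"

definition L0pos :: "nat \<Rightarrow> ('a \<Rightarrow> real) set" where
  "L0pos t = {e \<in> borel_measurable (F t). AE \<omega> in M. 0 < e \<omega>}"

definition adapted :: "(nat \<Rightarrow> 'a \<Rightarrow> real) set" where
  "adapted = {X. \<forall>s\<le>T. X s \<in> borel_measurable (F s)}"

text \<open>
  The processes that are constant from time \<open>t - 1\<close> on. They enter only through their values
  before \<open>t\<close>, so that the truncated subtraction at \<open>t = 0\<close> is harmless.
\<close>

definition pasts :: "nat \<Rightarrow> (nat \<Rightarrow> 'a \<Rightarrow> real) set" where
  "pasts t = {X \<in> adapted. \<forall>s\<in>{t..T}. AE \<omega> in M. X s \<omega> = X (t - 1) \<omega>}"

definition LpO :: "ennreal \<Rightarrow> nat \<Rightarrow> (nat \<Rightarrow> 'a \<Rightarrow> real) set" where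
  "LpO q t = {Z \<in> on_times {t..T} ` adapted.
     (\<lambda>(\<omega>, s). Z s \<omega>) \<in> Lp (M \<Otimes>\<^sub>M point_measure {t..T} (\<lambda>s. ennreal (\<mu> t s))) q}"

definition LtpO :: "ennreal \<Rightarrow> nat \<Rightarrow> (nat \<Rightarrow> 'a \<Rightarrow> real) set" where
  "LtpO q t = {(\<lambda>k \<omega>. l \<omega> * Z k \<omega>) | l Z. l \<in> borel_measurable (F t) \<and> Z \<in> LpO q t}"

definition XX :: "nat \<Rightarrow> (nat \<Rightarrow> 'a \<Rightarrow> real) set" where
  "XX t = {X \<in> adapted. on_times {t..T} X \<in> LtpO p t}"

text \<open>
  The conditional expectations below are the generalised ones: on the module \<open>LtpO\<close> the integrands
  need not be integrable, but \<open>nn_cond_exp\<close> of their positive and negative parts is almost surely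
  finite.
\<close>

definition cond_norm :: "nat \<Rightarrow> (nat \<Rightarrow> 'a \<Rightarrow> real) \<Rightarrow> 'a \<Rightarrow> real" where
  "cond_norm t X = (\<lambda>\<omega>. enn2real (nn_cond_exp M (F t)
     (\<lambda>\<omega>. ennreal (\<Sum>k=t..T. \<bar>X k \<omega>\<bar> powr enn2real p * \<mu> t k)) \<omega>) powr (1 / enn2real p))"

definition nhds_zero :: "nat \<Rightarrow> (nat \<Rightarrow> 'a \<Rightarrow> real) set set" where
  "nhds_zero t =
    (if p = \<infinity>
     then {{X \<in> LtpO p t. \<forall>L\<in>\<A>. AE \<omega> in M.
              \<bar>real_cond_exp M (F t) (\<lambda>\<omega>. \<Sum>k=t..T. X k \<omega> * L k \<omega> * \<mu> t k) \<omega>\<bar> \<le> e \<omega>}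
           | \<A> e. finite \<A> \<and> \<A> \<subseteq> LtpO 1 t \<and> e \<in> L0pos t}
     else {{X \<in> LtpO p t. AE \<omega> in M. cond_norm t X \<omega> \<le> e \<omega>} | e. e \<in> L0pos t})"

definition is_open_Ltp :: "nat \<Rightarrow> (nat \<Rightarrow> 'a \<Rightarrow> real) set \<Rightarrow> bool" where
  "is_open_Ltp t V \<longleftrightarrow>
     V \<subseteq> LtpO p t \<and> (\<forall>X\<in>V. \<exists>U\<in>nhds_zero t. {Y \<in> LtpO p t. Y - X \<in> U} \<subseteq> V)"

definition Ltp_topology :: "nat \<Rightarrow> (nat \<Rightarrow> 'a \<Rightarrow> real) topology" where
  "Ltp_topology t = topology (is_open_Ltp t)"

lemma L0pos_min: "e \<in> L0pos t \<Longrightarrow> e' \<in> L0pos t \<Longrightarrow> (\<lambda>\<omega>. min (e \<omega>) (e' \<omega>)) \<in> L0pos t"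
  by (auto simp: L0pos_def)

lemma L0pos_one: "(\<lambda>_. 1) \<in> L0pos t"
  by (auto simp: L0pos_def)

lemma nhds_zero_nonempty: "nhds_zero t \<noteq> {}"
  using L0pos_one[of t] unfolding nhds_zero_def by (auto intro: exI[of _ "{}"])

lemma nhds_zero_Int:
  assumes "U \<in> nhds_zero t" "V \<in> nhds_zero t"
  shows "\<exists>W\<in>nhds_zero t. W \<subseteq> U \<inter> V"
proof (cases "p = \<infinity>")
  case True
  define N where "N = (\<lambda>\<A> e. {X \<in> LtpO p t. \<forall>L\<in>\<A>. AE \<omega> in M.
      \<bar>real_cond_exp M (F t) (\<lambda>\<omega>. \<Sum>k=t..T. X k \<omega> * L k \<omega> * \<mu> t k) \<omega>\<bar> \<le> e \<omega>})"
  have nh: "nhds_zero t = {N \<A> e | \<A> e. finite \<A> \<and> \<A> \<subseteq> LtpO 1 t \<and> e \<in> L0pos t}"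
    unfolding nhds_zero_def N_def using True by simp
  obtain A a B b where U: "U = N A a" "finite A" "A \<subseteq> LtpO 1 t" "a \<in> L0pos t"
    and V: "V = N B b" "finite B" "B \<subseteq> LtpO 1 t" "b \<in> L0pos t"
    using assms unfolding nh by blast
  let ?e = "\<lambda>\<omega>. min (a \<omega>) (b \<omega>)"
  have "N (A \<union> B) ?e \<in> nhds_zero t"
    unfolding nh using U V L0pos_min by blast
  moreover have "N (A \<union> B) ?e \<subseteq> U \<inter> V"
    unfolding U V N_def by fastforce
  ultimately show ?thesis by blast
next
  case False
  define N where "N = (\<lambda>e. {X \<in> LtpO p t. AE \<omega> in M. cond_norm t X \<omega> \<le> e \<omega>})"
  have nh: "nhds_zero t = {N e | e. e \<in> L0pos t}"
    unfolding nhds_zero_def N_def using False by simp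
  obtain a b where U: "U = N a" "a \<in> L0pos t" and V: "V = N b" "b \<in> L0pos t"
    using assms unfolding nh by blast
  have "N (\<lambda>\<omega>. min (a \<omega>) (b \<omega>)) \<in> nhds_zero t"
    unfolding nh using U V L0pos_min by blast
  moreover have "N (\<lambda>\<omega>. min (a \<omega>) (b \<omega>)) \<subseteq> U \<inter> V"
    unfolding U V N_def by auto
  ultimately show ?thesis by blast
qed

lemma istopology_is_open_Ltp: "istopology (is_open_Ltp t)"
  unfolding istopology_def
proof (intro conjI allI impI)
  fix S S' assume S: "is_open_Ltp t S" and S': "is_open_Ltp t S'"
  show "is_open_Ltp t (S \<inter> S')"
    unfolding is_open_Ltp_def
  proof (intro conjI ballI)
    show "S \<inter> S' \<subseteq> LtpO p t" using S by (auto simp: is_open_Ltp_def)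
    fix X assume X: "X \<in> S \<inter> S'"
    obtain U U' where U: "U \<in> nhds_zero t" "{Y \<in> LtpO p t. Y - X \<in> U} \<subseteq> S"
      and U': "U' \<in> nhds_zero t" "{Y \<in> LtpO p t. Y - X \<in> U'} \<subseteq> S'"
      using S S' X unfolding is_open_Ltp_def by (meson IntD1 IntD2)
    obtain W where "W \<in> nhds_zero t" "W \<subseteq> U \<inter> U'"
      using nhds_zero_Int U(1) U'(1) by blast
    then show "\<exists>W\<in>nhds_zero t. {Y \<in> LtpO p t. Y - X \<in> W} \<subseteq> S \<inter> S'"
      using U(2) U'(2) by blast
  qed
next
  fix \<K> assume K: "\<forall>S\<in>\<K>. is_open_Ltp t S"
  show "is_open_Ltp t (\<Union>\<K>)"
    unfolding is_open_Ltp_def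
  proof (intro conjI ballI)
    show "\<Union>\<K> \<subseteq> LtpO p t" using K by (auto simp: is_open_Ltp_def)
    fix X assume "X \<in> \<Union>\<K>"
    then obtain S where S: "S \<in> \<K>" "X \<in> S" by blast
    then obtain U where "U \<in> nhds_zero t" "{Y \<in> LtpO p t. Y - X \<in> U} \<subseteq> S"
      using K unfolding is_open_Ltp_def by blast
    then show "\<exists>U\<in>nhds_zero t. {Y \<in> LtpO p t. Y - X \<in> U} \<subseteq> \<Union>\<K>"
      using S by blast
  qed
qed

lemma openin_Ltp_topology: "openin (Ltp_topology t) V \<longleftrightarrow> is_open_Ltp t V"
  unfolding Ltp_topology_def by (simp add: topology_inverse' istopology_is_open_Ltp)

lemma topspace_Ltp_topology: "topspace (Ltp_topology t) = LtpO p t"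
proof
  have "is_open_Ltp t (LtpO p t)"
    using nhds_zero_nonempty by (auto simp: is_open_Ltp_def)
  then show "LtpO p t \<subseteq> topspace (Ltp_topology t)"
    by (metis openin_Ltp_topology openin_subset)
  show "topspace (Ltp_topology t) \<subseteq> LtpO p t"
    by (metis openin_Ltp_topology openin_topspace is_open_Ltp_def)
qed

text \<open>
  Here \<open>b\<close> stands for the map \<open>X\<^bsub>[t,T]\<^esub> \<mapsto> \<alpha>\<^sub>t (Y\<^bsub>[0,t-1]\<^esub> + X\<^bsub>[t,T]\<^esub>)\<close> with a fixed past \<open>Y\<close>.
\<close>

definition local_map :: "nat \<Rightarrow> ((nat \<Rightarrow> 'a \<Rightarrow> real) \<Rightarrow> 'a \<Rightarrow> ereal) \<Rightarrow> bool" where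
  "local_map t b \<longleftrightarrow> (\<forall>X\<in>LtpO p t. \<forall>Y\<in>LtpO p t. \<forall>A\<in>sets (F t). AE \<omega> in M.
     b (\<lambda>k \<omega>. if \<omega> \<in> A then X k \<omega> else Y k \<omega>) \<omega> = (if \<omega> \<in> A then b X \<omega> else b Y \<omega>))"

definition quasiconcave_map :: "nat \<Rightarrow> ((nat \<Rightarrow> 'a \<Rightarrow> real) \<Rightarrow> 'a \<Rightarrow> ereal) \<Rightarrow> bool" where
  "quasiconcave_map t b \<longleftrightarrow> (\<forall>X\<in>LtpO p t. \<forall>Y\<in>LtpO p t. \<forall>l\<in>borel_measurable (F t).
     (AE \<omega> in M. 0 \<le> l \<omega> \<and> l \<omega> \<le> 1) \<longrightarrow>
     (AE \<omega> in M. b (\<lambda>k \<omega>. l \<omega> * X k \<omega> + (1 - l \<omega>) * Y k \<omega>) \<omega> \<ge> min (b X \<omega>) (b Y \<omega>)))"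

definition monotone_map :: "nat \<Rightarrow> ((nat \<Rightarrow> 'a \<Rightarrow> real) \<Rightarrow> 'a \<Rightarrow> ereal) \<Rightarrow> bool" where
  "monotone_map t b \<longleftrightarrow> (\<forall>X\<in>LtpO p t. \<forall>Y\<in>LtpO p t.
     (\<forall>k\<in>{t..T}. AE \<omega> in M. X k \<omega> \<le> Y k \<omega>) \<longrightarrow> (AE \<omega> in M. b X \<omega> \<le> b Y \<omega>))"

definition upper_semicontinuous_map :: "nat \<Rightarrow> ((nat \<Rightarrow> 'a \<Rightarrow> real) \<Rightarrow> 'a \<Rightarrow> ereal) \<Rightarrow> bool" where
  "upper_semicontinuous_map t b \<longleftrightarrow> (\<forall>m\<in>borel_measurable (F t).
     closedin (Ltp_topology t) {X \<in> LtpO p t. AE \<omega> in M. b X \<omega> \<ge> m \<omega>})"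

definition bounded_map :: "nat \<Rightarrow> ((nat \<Rightarrow> 'a \<Rightarrow> real) \<Rightarrow> 'a \<Rightarrow> ereal) \<Rightarrow> bool" where
  "bounded_map t b \<longleftrightarrow> (\<forall>X\<in>LtpO p t. \<exists>m1\<in>LpF t. \<exists>m2\<in>LpF t.
     (AE \<omega> in M. b (const_on {t..T} m1) \<omega> < b X \<omega>) \<and>
     (AE \<omega> in M. b X \<omega> \<le> b (const_on {t..T} m2) \<omega>))"

definition sensitive_map :: "nat \<Rightarrow> ((nat \<Rightarrow> 'a \<Rightarrow> real) \<Rightarrow> 'a \<Rightarrow> ereal) \<Rightarrow> bool" where
  "sensitive_map t b \<longleftrightarrow> (\<forall>m\<in>borel_measurable (F t). \<forall>Y\<in>LtpO p t. \<forall>A\<in>sets (F t).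
     (AE \<omega> in M. \<omega> \<in> A \<longrightarrow> b (const_on {t..T} m) \<omega> > b Y \<omega>) \<longrightarrow>
     (\<exists>e\<in>borel_measurable (F t). (AE \<omega> in M. 0 \<le> e \<omega>) \<and> (AE \<omega> in M. \<omega> \<in> A \<longrightarrow> 0 < e \<omega>) \<and>
        (AE \<omega> in M. \<omega> \<in> A \<longrightarrow> b (const_on {t..T} (\<lambda>\<omega>. m \<omega> - e \<omega>)) \<omega> \<ge> b Y \<omega>)))"

definition strictly_increasing_map :: "nat \<Rightarrow> ((nat \<Rightarrow> 'a \<Rightarrow> real) \<Rightarrow> 'a \<Rightarrow> ereal) \<Rightarrow> bool" where
  "strictly_increasing_map t b \<longleftrightarrow>
     (\<forall>m\<in>borel_measurable (F t). \<forall>m'\<in>borel_measurable (F t). \<forall>A\<in>sets (F t).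
       (AE \<omega> in M. \<omega> \<in> A \<longrightarrow> m \<omega> > m' \<omega>) \<longrightarrow>
       (AE \<omega> in M. \<omega> \<in> A \<longrightarrow> b (const_on {t..T} m) \<omega> > b (const_on {t..T} m') \<omega>))"

text \<open>
  The first two clauses say that \<open>a\<close> induces a map from almost sure classes of processes to almost
  sure classes of \<open>F t\<close>-measurable extended real random variables.
\<close>

definition usc_assessment_index ::
  "nat \<Rightarrow> ((nat \<Rightarrow> 'a \<Rightarrow> real) \<Rightarrow> 'a \<Rightarrow> ereal) \<Rightarrow> bool" where
  "usc_assessment_index t a \<longleftrightarrow>
     (\<forall>X\<in>XX t. a X \<in> borel_measurable (F t)) \<and>
     (\<forall>X\<in>XX t. \<forall>Y\<in>XX t. (\<forall>s\<le>T. AE \<omega> in M. X s \<omega> = Y s \<omega>) \<longrightarrow> (AE \<omega> in M. a X \<omega> = a Y \<omega>)) \<and>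
     (\<forall>Y\<in>pasts t. let b = (\<lambda>X. a (on_times {..<t} Y + X)) in
        local_map t b \<and> quasiconcave_map t b \<and> monotone_map t b \<and> upper_semicontinuous_map t b)"

definition dynamic_assessment_index ::
  "(nat \<Rightarrow> (nat \<Rightarrow> 'a \<Rightarrow> real) \<Rightarrow> 'a \<Rightarrow> ereal) \<Rightarrow> bool" where
  "dynamic_assessment_index \<alpha> \<longleftrightarrow> (\<forall>t\<le>T. usc_assessment_index t (\<alpha> t))"

definition bounded_sensitive_increasing ::
  "(nat \<Rightarrow> (nat \<Rightarrow> 'a \<Rightarrow> real) \<Rightarrow> 'a \<Rightarrow> ereal) \<Rightarrow> bool" where
  "bounded_sensitive_increasing \<alpha> \<longleftrightarrow>
     (\<forall>t\<le>T. \<forall>Y\<in>pasts t. let b = (\<lambda>X. \<alpha> t (on_times {..<t} Y + X)) in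
        bounded_map t b \<and> sensitive_map t b \<and> strictly_increasing_map t b)"

definition strongly_time_consistent ::
  "(nat \<Rightarrow> (nat \<Rightarrow> 'a \<Rightarrow> real) \<Rightarrow> 'a \<Rightarrow> ereal) \<Rightarrow> bool" where
  "strongly_time_consistent \<alpha> \<longleftrightarrow>
     (\<forall>t<T. \<forall>X\<in>XX t. \<forall>Y\<in>XX t. (\<forall>s\<le>t. AE \<omega> in M. X s \<omega> = Y s \<omega>) \<longrightarrow>
        (AE \<omega> in M. \<alpha> (t + 1) X \<omega> \<ge> \<alpha> (t + 1) Y \<omega>) \<longrightarrow> (AE \<omega> in M. \<alpha> t X \<omega> \<ge> \<alpha> t Y \<omega>))"

definition certainty_equivalent ::
  "(nat \<Rightarrow> (nat \<Rightarrow> 'a \<Rightarrow> real) \<Rightarrow> 'a \<Rightarrow> ereal) \<Rightarrow> nat \<Rightarrow> (nat \<Rightarrow> 'a \<Rightarrow> real) \<Rightarrow> 'a \<Rightarrow> ereal" where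
  "certainty_equivalent \<alpha> t X = ess_inf M (F t)
     {m \<in> LpF t. AE \<omega> in M. \<alpha> t (on_times {..<t} X + const_on {t..T} m) \<omega> \<ge> \<alpha> t X \<omega>}"

end

end

theory Submission
  imports Defs
begin

text \<open>
  The heart of the matter is that the certainty equivalent \<open>c = C\<^bsub>t+1\<^esub>(X)\<close> is attained:
  \<open>\<alpha>\<^bsub>t+1\<^esub>(X\<^bsub>[0,t]\<^esub> + c 1\<^bsub>[t+1,T]\<^esub>) = \<alpha>\<^bsub>t+1\<^esub>(X)\<close>. For \<open>\<ge>\<close>, write \<open>c\<close> as the infimum of a sequence of
  admissible constants. Locality and monotonicity make \<open>c + \<epsilon>\<close> admissible for every strictly positive
  \<open>\<epsilon>\<close>, and every conditional neighbourhood of zero contains such a constant, so upper semicontinuity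
  applies. For \<open>\<le>\<close>, sensitivity would yield an admissible constant strictly below \<open>c\<close> on the set where
  the inequality fails. Strict increase together with boundedness keeps \<open>c\<close> in \<open>L\<^sup>p\<close>.
  Strong time consistency, applied in both directions, then makes \<open>X\<close> and \<open>X\<^bsub>[0,t]\<^esub> + c 1\<^bsub>[t+1,T]\<^esub>\<close>
  equivalent at time \<open>t\<close>; as they share their past, the sets defining their certainty equivalents
  coincide.
\<close>

section \<open>Essential infima\<close>

lemma is_ess_inf_unique:
  assumes "is_ess_inf M G S Z" "is_ess_inf M G S Z'"
  shows "AE \<omega> in M. Z \<omega> = Z' \<omega>"
proof -
  have "AE \<omega> in M. Z \<omega> \<le> Z' \<omega>" "AE \<omega> in M. Z' \<omega> \<le> Z \<omega>"
    using assms unfolding is_ess_inf_def by blast+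
  then show ?thesis by eventually_elim auto
qed

text \<open>An order embedding of the extended reals into a bounded interval, so that the
  expectation of any measurable infimum exists. The infinite values are set separately because
  \<open>real_of_ereal\<close> sends both of them to 0.\<close>

definition arctan_ereal :: "ereal \<Rightarrow> real" where
  "arctan_ereal x = (if x = \<infinity> then pi / 2 else if x = - \<infinity> then - (pi / 2)
    else arctan (real_of_ereal x))"

lemma arctan_ereal_less_iff: "arctan_ereal x < arctan_ereal y \<longleftrightarrow> x < y"
  using arctan_lbound arctan_ubound
  by (cases x; cases y)
    (auto simp: arctan_ereal_def arctan_less_iff not_less less_imp_le[OF arctan_ubound]
      intro: less_imp_le order.strict_trans[of _ 0])

lemma arctan_ereal_le_iff: "arctan_ereal x \<le> arctan_ereal y \<longleftrightarrow> x \<le> y"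
  by (meson arctan_ereal_less_iff not_less)

lemma abs_arctan_ereal_le: "\<bar>arctan_ereal x\<bar> \<le> pi / 2"
  using arctan_lbound[of "real_of_ereal x"] arctan_ubound[of "real_of_ereal x"]
  by (auto simp: arctan_ereal_def abs_le_iff)

lemma borel_measurable_arctan_ereal [measurable]: "arctan_ereal \<in> borel_measurable borel"
  unfolding arctan_ereal_def by measurable

text \<open>
  Among the infima of sequences in \<open>S\<close>, one that minimises the expectation of a bounded strictly
  increasing function is almost surely minimal.
\<close>

lemma (in finite_measure) ess_inf_eq_INF:
  assumes sub: "subalgebra M G" and S: "S \<subseteq> borel_measurable G" "S \<noteq> {}"
  obtains s :: "nat \<Rightarrow> 'a \<Rightarrow> real"
  where "range s \<subseteq> S" "is_ess_inf M G S (\<lambda>\<omega>. INF n. ereal (s n \<omega>))"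
proof -
  define inf where "inf s \<omega> = (INF n. ereal (s n \<omega>))" for s :: "nat \<Rightarrow> 'a \<Rightarrow> real" and \<omega>
  define J where "J s = (\<integral>\<omega>. arctan_ereal (inf s \<omega>) \<partial>M)" for s
  define R where "R = {s :: nat \<Rightarrow> 'a \<Rightarrow> real. range s \<subseteq> S}"
  have inf_G: "inf s \<in> borel_measurable G" if "s \<in> R" for s
  proof -
    have [measurable]: "s n \<in> borel_measurable G" for n using that S by (auto simp: R_def)
    show ?thesis unfolding inf_def by measurable
  qed
  have int: "integrable M (\<lambda>\<omega>. arctan_ereal (inf s \<omega>))" if "s \<in> R" for s
  proof (rule integrable_const_bound[of _ "pi / 2"])
    have [measurable]: "inf s \<in> borel_measurable M"
      using measurable_from_subalg[OF sub inf_G[OF that]] .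
    show "(\<lambda>\<omega>. arctan_ereal (inf s \<omega>)) \<in> borel_measurable M" by measurable
  qed (use abs_arctan_ereal_le in simp)
  have J_mono: "J s \<le> J s'" if "s \<in> R" "s' \<in> R" and sub: "range s' \<subseteq> range s" for s s'
    unfolding J_def
  proof (rule integral_mono[OF int int])
    show "arctan_ereal (inf s \<omega>) \<le> arctan_ereal (inf s' \<omega>)" for \<omega>
      unfolding arctan_ereal_le_iff inf_def
    proof (rule INF_mono)
      fix n
      obtain k where "s' n = s k" using sub by blast
      then show "\<exists>k\<in>UNIV. ereal (s k \<omega>) \<le> ereal (s' n \<omega>)" by auto
    qed
  qed (use that in auto)
  obtain m0 where m0: "m0 \<in> S" using S by blast
  then have "(\<lambda>_. m0) \<in> R" by (auto simp: R_def)
  then have ne: "J ` R \<noteq> {}" by blast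
  have bdd: "bdd_below (J ` R)"
  proof (rule bdd_belowI2)
    fix s assume "s \<in> R"
    have "(\<integral>\<omega>. - (pi / 2) \<partial>M) \<le> J s"
      unfolding J_def
    proof (rule integral_mono[OF _ int[OF \<open>s \<in> R\<close>]])
      show "- (pi / 2) \<le> arctan_ereal (inf s \<omega>)" for \<omega>
        using abs_arctan_ereal_le[of "inf s \<omega>"] by linarith
    qed simp
    then show "(\<integral>\<omega>. - (pi / 2) \<partial>M) \<le> J s" .
  qed
  have "\<exists>s\<in>R. J s < Inf (J ` R) + 1 / Suc k" for k
    using cInf_lessD[OF ne, of "Inf (J ` R) + 1 / Suc k"] by auto
  then obtain r where r: "r k \<in> R" "J (r k) < Inf (J ` R) + 1 / Suc k" for k
    by metis
  \<comment> \<open>A pairing function merges the countably many nearly minimising sequences into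
    one. Its infimum lies below each of theirs, so \<open>J\<close> attains its minimum at
    \<open>s\<close>.\<close>
  define s where "s n = (case prod_decode n of (k, j) \<Rightarrow> r k j)" for n
  have s: "s \<in> R" using r(1) by (force simp: R_def s_def split: prod.split)
  have rs: "range (r k) \<subseteq> range s" for k
  proof -
    have "r k j = s (prod_encode (k, j))" for j by (simp add: s_def)
    then show ?thesis by blast
  qed
  have "J s \<le> Inf (J ` R) + 1 / Suc k" for k
    using J_mono[OF s r(1) rs, of k] r(2)[of k] by linarith
  then have "J s \<le> Inf (J ` R) + e" if "e > 0" for e
    using nat_approx_posE[OF that] by (smt (verit))
  then have J_min: "J s \<le> J s'" if "s' \<in> R" for s'
    using cInf_lower[OF _ bdd, of "J s'"] that by (meson field_le_epsilon imageI order_trans)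
  have "is_ess_inf M G S (inf s)"
    unfolding is_ess_inf_def
  proof (intro conjI ballI impI)
    show "inf s \<in> borel_measurable G" by (rule inf_G[OF s])
    fix m assume m: "m \<in> S"
    \<comment> \<open>Prepending \<open>m\<close> can only lower the infimum, while minimality of
      \<open>J s\<close> forbids a smaller expectation. Ordered integrable functions with equal
      integrals agree almost surely, so the infimum along \<open>s\<close> already lies below
      \<open>m\<close>.\<close>
    define s' where "s' = case_nat m s"
    have s': "s' \<in> R" using s m by (force simp: R_def s'_def split: nat.split)
    have "J s' = J s"
    proof (rule antisym[OF J_mono[OF s' s] J_min[OF s']])
      have "s n = s' (Suc n)" for n by (simp add: s'_def)
      then show "range s \<subseteq> range s'" by blast
    qed
    moreover have le: "arctan_ereal (inf s' \<omega>) \<le> arctan_ereal (inf s \<omega>)" for \<omega>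
      unfolding arctan_ereal_le_iff inf_def
    proof (rule INF_mono)
      fix n
      show "\<exists>k\<in>UNIV. ereal (s' k \<omega>) \<le> ereal (s n \<omega>)"
        by (rule bexI[of _ "Suc n"]) (simp_all add: s'_def)
    qed
    ultimately have "AE \<omega> in M. arctan_ereal (inf s' \<omega>) = arctan_ereal (inf s \<omega>)"
      using int[OF s] int[OF s']
      by (intro integral_ineq_eq_0_then_AE) (auto simp: J_def)
    then show "AE \<omega> in M. inf s \<omega> \<le> ereal (m \<omega>)"
    proof eventually_elim
      case (elim \<omega>)
      then have "inf s \<omega> \<le> inf s' \<omega>" by (metis arctan_ereal_le_iff order_refl)
      also have "\<dots> \<le> ereal (s' 0 \<omega>)" unfolding inf_def by (rule INF_lower) simp
      finally show ?case by (simp add: s'_def)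
    qed
  next
    fix W :: "'a \<Rightarrow> ereal" assume "\<forall>m\<in>S. AE \<omega> in M. W \<omega> \<le> ereal (m \<omega>)"
    then have "AE \<omega> in M. \<forall>n. W \<omega> \<le> ereal (s n \<omega>)"
      using s by (auto simp: AE_all_countable R_def)
    then show "AE \<omega> in M. W \<omega> \<le> inf s \<omega>"
      by eventually_elim (auto simp: inf_def intro: INF_greatest)
  qed
  then show thesis
    using that[of s] s by (simp add: inf_def[abs_def] R_def)
qed

section \<open>Conditional \<open>L\<^sup>p\<close> spaces of processes\<close>

text \<open>Serves both for a variable squeezed between two members of L^p and for a bounded
  perturbation of one member. For a finite exponent, a sum is at most twice the maximum, whence the
  factor \<open>2 powr ?r\<close>; for the infinite exponent the two bounds add up.\<close>

lemma Lp_dominated: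
  assumes f: "f \<in> borel_measurable N" and g: "g \<in> Lp N q" and h: "h \<in> Lp N q"
    and le: "AE x in N. \<bar>f x\<bar> \<le> \<bar>g x\<bar> + \<bar>h x\<bar>"
  shows "f \<in> Lp N q"
proof (cases "q = \<infinity>")
  case True
  then obtain c d where "AE x in N. \<bar>g x\<bar> \<le> c" "AE x in N. \<bar>h x\<bar> \<le> d"
    using g h by (auto simp: Lp_def)
  with le have "AE x in N. \<bar>f x\<bar> \<le> c + d"
    by eventually_elim linarith
  then show ?thesis using f True by (auto simp: Lp_def)
next
  case False
  let ?r = "enn2real q"
  have [measurable]: "f \<in> borel_measurable N" by fact
  have "integrable N (\<lambda>x. 2 powr ?r * (\<bar>g x\<bar> powr ?r + \<bar>h x\<bar> powr ?r))"
    using g h False by (auto simp: Lp_def)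
  then have "integrable N (\<lambda>x. \<bar>f x\<bar> powr ?r)"
  proof (rule Bochner_Integration.integrable_bound)
    show "AE x in N. norm (\<bar>f x\<bar> powr ?r)
        \<le> norm (2 powr ?r * (\<bar>g x\<bar> powr ?r + \<bar>h x\<bar> powr ?r))"
      using le
    proof eventually_elim
      case (elim x)
      have "\<bar>f x\<bar> powr ?r \<le> (2 * max \<bar>g x\<bar> \<bar>h x\<bar>) powr ?r"
        using elim by (intro powr_mono2) auto
      also have "\<dots> = 2 powr ?r * max \<bar>g x\<bar> \<bar>h x\<bar> powr ?r"
        by (intro powr_mult)
      also have "\<dots> \<le> 2 powr ?r * (\<bar>g x\<bar> powr ?r + \<bar>h x\<bar> powr ?r)"
        by (intro mult_left_mono) (auto simp: max_def)
      finally show ?case by simp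
    qed
  qed measurable
  then show ?thesis using f False by (auto simp: Lp_def)
qed

lemma (in finite_measure) const_in_Lp: "(\<lambda>_. c) \<in> Lp M q"
  by (auto simp: Lp_def)

text \<open>There are finitely many times, each of positive finite mass. Hence a property holds
  almost everywhere on the product iff it does so at every time, and the product integral is a
  finite positive combination of the integrals at single times.\<close>

lemma (in sigma_finite_measure) Lp_pair_point_measure:
  fixes w :: "nat \<Rightarrow> real"
  assumes A: "finite A" and w: "\<And>s. s \<in> A \<Longrightarrow> 0 < w s"
    and Z: "\<And>s. s \<in> A \<Longrightarrow> Z s \<in> borel_measurable M"
  shows "(\<lambda>(\<omega>, s). Z s \<omega>) \<in> Lp (M \<Otimes>\<^sub>M point_measure A (\<lambda>s. ennreal (w s))) q
    \<longleftrightarrow> (\<forall>s\<in>A. Z s \<in> Lp M q)"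
proof -
  define N where "N = point_measure A (\<lambda>s. ennreal (w s))"
  have sets_N [measurable_cong]: "sets N = sets (count_space A)"
    by (simp add: N_def sets_point_measure_count_space)
  interpret N: finite_measure N
    by standard (simp add: N_def emeasure_point_measure_finite A space_point_measure)
  interpret P: pair_sigma_finite M N ..
  have AE_N: "(AE s in N. P s) \<longleftrightarrow> (\<forall>s\<in>A. P s)" for P
    using w unfolding N_def AE_point_measure by auto
  define f where "f = (\<lambda>(\<omega>, s). Z s \<omega>)"
  \<comment> \<open>Since the time coordinate has countable range, joint measurability follows from
    measurability at each fixed time.\<close>
  have "f \<in> borel_measurable (M \<Otimes>\<^sub>M count_space A)"
    unfolding f_def split_beta
    by (rule measurable_compose_countable'[where f = "\<lambda>s x. Z s (fst x)" and g = snd and I = A])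
      (use A Z in \<open>auto intro: countable_finite\<close>)
  then have f [measurable]: "f \<in> borel_measurable (M \<Otimes>\<^sub>M N)"
    by (simp cong: measurable_cong_sets add: sets_pair_measure_cong[OF refl sets_N])
  show ?thesis
  proof (cases "q = \<infinity>")
    case True
    have bound: "(AE x in M \<Otimes>\<^sub>M N. \<bar>f x\<bar> \<le> c) \<longleftrightarrow> (\<forall>s\<in>A. AE \<omega> in M. \<bar>Z s \<omega>\<bar> \<le> c)" for c
    proof -
      have "{x \<in> space (M \<Otimes>\<^sub>M N). \<bar>f (fst x, snd x)\<bar> \<le> c} \<in> sets (M \<Otimes>\<^sub>M N)" by measurable
      from P.AE_pair_iff[of "\<lambda>\<omega> s. \<bar>f (\<omega>, s)\<bar> \<le> c", OF this]
      have "(AE x in M \<Otimes>\<^sub>M N. \<bar>f x\<bar> \<le> c) \<longleftrightarrow> (AE \<omega> in M. AE s in N. \<bar>Z s \<omega>\<bar> \<le> c)"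
        by (simp add: f_def)
      also have "\<dots> \<longleftrightarrow> (AE \<omega> in M. \<forall>s\<in>A. \<bar>Z s \<omega>\<bar> \<le> c)"
        by (simp add: AE_N)
      also have "\<dots> \<longleftrightarrow> (\<forall>s\<in>A. AE \<omega> in M. \<bar>Z s \<omega>\<bar> \<le> c)"
        using A by (rule AE_finite_all)
      finally show ?thesis .
    qed
    have "(\<exists>c. \<forall>s\<in>A. AE \<omega> in M. \<bar>Z s \<omega>\<bar> \<le> c) \<longleftrightarrow> (\<forall>s\<in>A. \<exists>c. AE \<omega> in M. \<bar>Z s \<omega>\<bar> \<le> c)"
    proof
      assume "\<forall>s\<in>A. \<exists>c. AE \<omega> in M. \<bar>Z s \<omega>\<bar> \<le> c"
      then obtain c where c: "\<forall>s\<in>A. AE \<omega> in M. \<bar>Z s \<omega>\<bar> \<le> c s" by metis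
      have "AE \<omega> in M. \<bar>Z s \<omega>\<bar> \<le> Max (c ` A)" if "s \<in> A" for s
      proof -
        have "c s \<le> Max (c ` A)" using A that by simp
        moreover have "AE \<omega> in M. \<bar>Z s \<omega>\<bar> \<le> c s" using c that by blast
        ultimately show ?thesis by (auto elim!: eventually_mono)
      qed
      then show "\<exists>c. \<forall>s\<in>A. AE \<omega> in M. \<bar>Z s \<omega>\<bar> \<le> c" by blast
    qed blast
    then show ?thesis
      using True Z f unfolding f_def[symmetric] N_def[symmetric] by (auto simp: Lp_def bound)
  next
    case False
    let ?r = "enn2real q"
    have Zm: "(\<lambda>\<omega>. \<bar>Z s \<omega>\<bar> powr ?r) \<in> borel_measurable M" if "s \<in> A" for s
      using Z[OF that] by measurable
    have "(\<integral>\<^sup>+ x. ennreal (\<bar>f x\<bar> powr ?r) \<partial>(M \<Otimes>\<^sub>M N))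
      = (\<integral>\<^sup>+ \<omega>. \<integral>\<^sup>+ s. ennreal (\<bar>Z s \<omega>\<bar> powr ?r) \<partial>N \<partial>M)"
      by (subst N.nn_integral_fst[symmetric]) (measurable, simp add: f_def)
    also have "\<dots> = (\<integral>\<^sup>+ \<omega>. (\<Sum>s\<in>A. ennreal (w s) * ennreal (\<bar>Z s \<omega>\<bar> powr ?r)) \<partial>M)"
      by (simp add: N_def nn_integral_point_measure_finite A)
    also have "\<dots> = (\<Sum>s\<in>A. ennreal (w s) * (\<integral>\<^sup>+ \<omega>. ennreal (\<bar>Z s \<omega>\<bar> powr ?r) \<partial>M))"
      using Zm by (subst nn_integral_sum) (auto simp: nn_integral_cmult)
    finally have eq: "(\<integral>\<^sup>+ x. ennreal (\<bar>f x\<bar> powr ?r) \<partial>(M \<Otimes>\<^sub>M N)) = \<dots>" .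
    have "integrable (M \<Otimes>\<^sub>M N) (\<lambda>x. \<bar>f x\<bar> powr ?r)
      \<longleftrightarrow> (\<integral>\<^sup>+ x. ennreal (\<bar>f x\<bar> powr ?r) \<partial>(M \<Otimes>\<^sub>M N)) < \<infinity>"
      by (simp add: integrable_iff_bounded)
    \<comment> \<open>Positive finite weights neither hide nor create an infinite integral.\<close>
    also have "\<dots> \<longleftrightarrow> (\<forall>s\<in>A. (\<integral>\<^sup>+ \<omega>. ennreal (\<bar>Z s \<omega>\<bar> powr ?r) \<partial>M) < \<infinity>)"
      unfolding eq using A w by (auto simp: ennreal_mult_less_top less_top[symmetric]
          ennreal_mult_eq_top_iff) (fastforce simp: not_less)+
    also have "\<dots> \<longleftrightarrow> (\<forall>s\<in>A. integrable M (\<lambda>\<omega>. \<bar>Z s \<omega>\<bar> powr ?r))"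
      using Zm by (auto simp: integrable_iff_bounded)
    finally show ?thesis
      using False Z f unfolding f_def[symmetric] N_def[symmetric] by (auto simp: Lp_def)
  qed
qed

section \<open>Membership in the conditional modules and in the domain of the index\<close>

context filtered_setting
begin

lemma finite_measure_subalgebra_F: "t \<le> T \<Longrightarrow> finite_measure_subalgebra M (F t)"
  by (intro finite_measure_subalgebra.intro finite_measure_axioms
      finite_measure_subalgebra_axioms.intro subalg)

lemma F_mono: "s \<le> r \<Longrightarrow> r \<le> T \<Longrightarrow> f \<in> measurable (F s) N \<Longrightarrow> f \<in> measurable (F r) N"
  using filt measurable_from_subalg by blast

lemma F_measurable: "s \<le> T \<Longrightarrow> f \<in> measurable (F s) N \<Longrightarrow> f \<in> measurable M N"
  using subalg measurable_from_subalg by blast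

lemma LpO_iff:
  "Z \<in> LpO q t \<longleftrightarrow> Z \<in> on_times {t..T} ` adapted \<and> (\<forall>k\<in>{t..T}. Z k \<in> Lp M q)"
proof (cases "Z \<in> on_times {t..T} ` adapted")
  case True
  then have "Z k \<in> borel_measurable M" if "k \<in> {t..T}" for k
    using that by (auto simp: on_times_def adapted_def intro: F_measurable[of k])
  then show ?thesis
    using Lp_pair_point_measure[of "{t..T}" "\<mu> t" Z q] True \<mu>_pos by (auto simp: LpO_def)
qed (auto simp: LpO_def)

lemma LtpOI:
  assumes "l \<in> borel_measurable (F t)" "W \<in> adapted" "\<And>k. k \<in> {t..T} \<Longrightarrow> W k \<in> Lp M q"
    and "\<And>k \<omega>. Z k \<omega> = (if k \<in> {t..T} then l \<omega> * W k \<omega> else 0)"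
  shows "Z \<in> LtpO q t"
proof -
  have "on_times {t..T} W \<in> LpO q t"
    using assms by (auto simp: LpO_iff on_times_def)
  moreover have "Z = (\<lambda>k \<omega>. l \<omega> * on_times {t..T} W k \<omega>)"
    using assms(4) by (auto simp: on_times_def fun_eq_iff)
  ultimately show ?thesis using assms(1) by (auto simp: LtpO_def)
qed

lemma LtpOE:
  assumes "Z \<in> LtpO q t"
  obtains l W where "l \<in> borel_measurable (F t)" "W \<in> adapted"
    "\<And>k. k \<in> {t..T} \<Longrightarrow> W k \<in> Lp M q"
    "\<And>k \<omega>. Z k \<omega> = (if k \<in> {t..T} then l \<omega> * W k \<omega> else 0)"
proof -
  obtain l Z' where l: "l \<in> borel_measurable (F t)" "Z' \<in> LpO q t"
    and Z: "Z = (\<lambda>k \<omega>. l \<omega> * Z' k \<omega>)"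
    using assms by (auto simp: LtpO_def)
  then obtain W where W: "W \<in> adapted" "Z' = on_times {t..T} W" "\<forall>k\<in>{t..T}. Z' k \<in> Lp M q"
    by (auto simp: LpO_iff)
  show thesis
    by (rule that[OF l(1) W(1)]) (use W(2,3) Z in \<open>auto simp: on_times_def\<close>)
qed

lemma LtpO_measurable:
  assumes "Z \<in> LtpO q t" "k \<le> T"
  shows "Z k \<in> borel_measurable (F k)"
proof -
  obtain l W where l: "l \<in> borel_measurable (F t)" and W: "W \<in> adapted"
    and Z: "\<And>k \<omega>. Z k \<omega> = (if k \<in> {t..T} then l \<omega> * W k \<omega> else 0)"
    using assms(1) by (rule LtpOE) blast
  show ?thesis
  proof (cases "t \<le> k")
    case True
    have [measurable]: "l \<in> borel_measurable (F k)" "W k \<in> borel_measurable (F k)"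
      using True assms(2) F_mono[OF _ _ l] W by (auto simp: adapted_def)
    have "Z k = (\<lambda>\<omega>. l \<omega> * W k \<omega>)" using True assms(2) Z by auto
    then show ?thesis by simp
  next
    case False
    then have "Z k = (\<lambda>_. 0)" using Z by auto
    then show ?thesis by simp
  qed
qed

lemma const_on_LtpO:
  assumes "m \<in> borel_measurable (F t)"
  shows "const_on {t..T} m \<in> LtpO q t"
  by (rule LtpOI[OF assms, of "\<lambda>_ _. 1"])
    (auto simp: adapted_def const_in_Lp on_times_def)

lemma LtpO_in_XX:
  assumes "X \<in> adapted" "Z \<in> LtpO p t"
  shows "on_times {..<t} X + Z \<in> XX t"
proof -
  have Z: "Z k \<omega> = 0" if "k \<notin> {t..T}" for k \<omega>
    using assms(2) that by (elim LtpOE) auto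
  have "(on_times {..<t} X + Z) k \<in> borel_measurable (F k)" if "k \<le> T" for k
  proof -
    have [measurable]: "X k \<in> borel_measurable (F k)" "Z k \<in> borel_measurable (F k)"
      using that assms LtpO_measurable by (auto simp: adapted_def)
    show ?thesis by (cases "k < t") (simp_all add: on_times_def plus_fun_def)
  qed
  then have "on_times {..<t} X + Z \<in> adapted" by (simp add: adapted_def)
  moreover have "on_times {t..T} (on_times {..<t} X + Z) = Z"
    using Z by (auto simp: on_times_def fun_eq_iff plus_fun_def)
  ultimately show ?thesis using assms(2) by (simp add: XX_def)
qed

text \<open>The factor taken out at time \<open>s\<close> is still measurable at the later time
  \<open>t\<close>, and dropping the times before \<open>t\<close> only removes conditions.\<close>

lemma XX_mono:
  assumes "s \<le> t" "t \<le> T"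
  shows "XX s \<subseteq> XX t"
proof
  fix X assume X: "X \<in> XX s"
  then obtain l W where l: "l \<in> borel_measurable (F s)" and W: "W \<in> adapted"
      "\<And>k. k \<in> {s..T} \<Longrightarrow> W k \<in> Lp M p"
    and eq: "\<And>k \<omega>. on_times {s..T} X k \<omega> = (if k \<in> {s..T} then l \<omega> * W k \<omega> else 0)"
    by (auto simp: XX_def elim: LtpOE)
  have "on_times {t..T} X k \<omega> = (if k \<in> {t..T} then l \<omega> * W k \<omega> else 0)" for k \<omega>
    using eq[of k \<omega>] assms by (auto simp: on_times_def)
  with W have "on_times {t..T} X \<in> LtpO p t"
    using assms by (intro LtpOI[OF F_mono[OF assms l] W(1)]) auto
  then show "X \<in> XX t" using X by (simp add: XX_def)
qed

text \<open>The value \<open>X t\<close> need not be integrable, but it is known at time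
  \<open>t\<close>, so the factor \<open>1 + \<bar>X t \<omega>\<bar>\<close> may be taken out. The
  remaining quotient \<open>W\<close> is bounded by 1 at time \<open>t\<close> and by the modulus of
  \<open>c\<close> afterwards, hence lies in L^p.\<close>

lemma const_continuation_in_XX:
  assumes X: "X \<in> adapted" and c: "c \<in> LpF (t + 1)" and t: "t < T"
  shows "on_times {..t} X + const_on {t + 1..T} c \<in> XX t"
proof -
  let ?l = "\<lambda>\<omega>. 1 + \<bar>X t \<omega>\<bar>"
  define W where "W k \<omega> = (if k < t then 0 else if k = t then X t \<omega> else c \<omega>) / ?l \<omega>" for k \<omega>
  define Z where "Z k \<omega> = (if k \<in> {t..T} then ?l \<omega> * W k \<omega> else 0)" for k \<omega>
  have Xt: "X t \<in> borel_measurable (F t)" using X t by (simp add: adapted_def)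
  have W: "W k \<in> borel_measurable (F k)" if "k \<le> T" for k
  proof (cases "k < t")
    case False
    then have [measurable]: "X t \<in> borel_measurable (F k)" using F_mono[OF _ that Xt] by simp
    show ?thesis
    proof (cases "k = t")
      case False
      then have [measurable]: "c \<in> borel_measurable (F k)"
        using \<open>\<not> k < t\<close> that c by (intro F_mono[of "t + 1" k]) (auto simp: LpF_def)
      show ?thesis unfolding W_def using False \<open>\<not> k < t\<close> by simp
    qed (use Xt in \<open>simp add: W_def[abs_def]\<close>)
  qed (simp add: W_def[abs_def])
  have "W k \<in> Lp M p" if "k \<in> {t..T}" for k
  proof (rule Lp_dominated[OF F_measurable[OF _ W]])
    show "c \<in> Lp M p" using c by (simp add: LpF_def)
    show "(\<lambda>_. 1) \<in> Lp M p" by (rule const_in_Lp)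
    have "\<bar>W k \<omega>\<bar> \<le> \<bar>c \<omega>\<bar> + \<bar>1\<bar>" for \<omega>
    proof (cases "k = t")
      case False
      then have "\<bar>W k \<omega>\<bar> = \<bar>c \<omega>\<bar> / ?l \<omega>" using that by (simp add: W_def)
      also have "\<dots> \<le> \<bar>c \<omega>\<bar> / 1" by (intro divide_left_mono) auto
      finally show ?thesis by simp
    next
      case True
      then have "\<bar>W k \<omega>\<bar> = \<bar>X t \<omega>\<bar> / ?l \<omega>" by (simp add: W_def)
      also have "\<dots> \<le> 1" by simp
      finally show ?thesis by simp
    qed
    then show "AE \<omega> in M. \<bar>W k \<omega>\<bar> \<le> \<bar>c \<omega>\<bar> + \<bar>1\<bar>" by simp
  qed (use that in auto)
  then have Z: "Z \<in> LtpO p t"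
    using Xt W by (intro LtpOI[of ?l t W]) (auto simp: adapted_def Z_def)
  \<comment> \<open>The denominator never vanishes, so multiplying \<open>W\<close> by
    \<open>?l\<close> gives back the original values.\<close>
  have "1 + \<bar>x\<bar> \<noteq> (0::real)" for x by linarith
  then have "on_times {..t} X + const_on {t + 1..T} c = on_times {..<t} X + Z"
    using t by (auto simp: fun_eq_iff plus_fun_def on_times_def Z_def W_def)
  then show ?thesis using LtpO_in_XX[OF X Z] by simp
qed

section \<open>Small constants and the conditional topology\<close>

text \<open>A factor measurable at time \<open>t\<close> comes out of the conditional expectation,
  so the size of a constant process is \<open>e\<close> times a quantity independent of
  \<open>e\<close>. Dividing the given radius by that quantity, or by a larger one, yields a
  suitable \<open>e\<close>.\<close>

lemma nhds_zero_const:
  assumes "t \<le> T" and U: "U \<in> nhds_zero t"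
  obtains e where "e \<in> L0pos t" "const_on {t..T} e \<in> U"
proof -
  interpret finite_measure_subalgebra M "F t" using assms(1) by (rule finite_measure_subalgebra_F)
  show thesis
  proof (cases "p = \<infinity>")
    case True
    then obtain \<A> d where fin: "finite \<A>" and \<A>: "\<A> \<subseteq> LtpO 1 t" and d: "d \<in> L0pos t"
      and U: "U = {X \<in> LtpO p t. \<forall>L\<in>\<A>. AE \<omega> in M.
        \<bar>real_cond_exp M (F t) (\<lambda>\<omega>. \<Sum>k=t..T. X k \<omega> * L k \<omega> * \<mu> t k) \<omega>\<bar> \<le> d \<omega>}"
      using U unfolding nhds_zero_def by auto
    define g where "g L \<omega> = (\<Sum>k=t..T. L k \<omega> * \<mu> t k)" for L and \<omega> :: 'a
    define v where "v L = real_cond_exp M (F t) (g L)" for L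
    \<comment> \<open>The sum controls all finitely many pairings at once and the summand 1 keeps
      the denominator positive. The modulus of \<open>d\<close> makes \<open>e\<close> nonnegative
      everywhere, as needed to multiply inside \<open>ennreal\<close>.\<close>
    define e where "e \<omega> = \<bar>d \<omega>\<bar> / (1 + (\<Sum>L\<in>\<A>. \<bar>v L \<omega>\<bar>))" for \<omega>
    have g: "g L \<in> borel_measurable M" if "L \<in> \<A>" for L
    proof -
      have "L k \<in> borel_measurable M" if "k \<in> {t..T}" for k
        using F_measurable[OF _ LtpO_measurable[of L 1 t k]] \<A> \<open>L \<in> \<A>\<close> that by auto
      then show ?thesis unfolding g_def by (intro borel_measurable_sum) auto
    qed
    have e_nonneg: "0 \<le> e \<omega>" for \<omega>
      unfolding e_def by (intro divide_nonneg_nonneg add_nonneg_nonneg sum_nonneg) auto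
    have [measurable]: "d \<in> borel_measurable (F t)" "v L \<in> borel_measurable (F t)" for L
      using d by (auto simp: L0pos_def v_def)
    have e_meas [measurable]: "e \<in> borel_measurable (F t)" unfolding e_def by measurable
    have "AE \<omega> in M. 0 < e \<omega>"
      using d unfolding L0pos_def
      by (auto simp: e_def intro!: divide_pos_pos add_pos_nonneg sum_nonneg elim!: eventually_mono)
    then have e: "e \<in> L0pos t" by (simp add: L0pos_def e_meas)
    have "AE \<omega> in M.
        \<bar>real_cond_exp M (F t) (\<lambda>\<omega>. \<Sum>k=t..T. const_on {t..T} e k \<omega> * L k \<omega> * \<mu> t k) \<omega>\<bar> \<le> d \<omega>"
      if L: "L \<in> \<A>" for L
    proof -
      have eq: "(\<lambda>\<omega>. \<Sum>k=t..T. const_on {t..T} e k \<omega> * L k \<omega> * \<mu> t k) = (\<lambda>\<omega>. e \<omega> * g L \<omega>)"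
        by (simp add: on_times_def g_def sum_distrib_left mult.assoc)
      have [measurable]: "g L \<in> borel_measurable M" by (rule g[OF L])
      \<comment> \<open>\<open>real_cond_exp_mult\<close> needs integrability, which fails on the module.\<close>
      have "AE \<omega> in M. nn_cond_exp M (F t) (\<lambda>\<omega>. ennreal (e \<omega> * h \<omega>)) \<omega>
          = ennreal (e \<omega>) * nn_cond_exp M (F t) (\<lambda>\<omega>. ennreal (h \<omega>)) \<omega>"
        if [measurable]: "h \<in> borel_measurable M" for h
      proof -
        have "AE \<omega> in M. ennreal (e \<omega>) * nn_cond_exp M (F t) (\<lambda>\<omega>. ennreal (h \<omega>)) \<omega>
            = nn_cond_exp M (F t) (\<lambda>\<omega>. ennreal (e \<omega>) * ennreal (h \<omega>)) \<omega>"
          by (rule nn_cond_exp_prod) measurable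
        then show ?thesis
          by eventually_elim (simp add: ennreal_mult' e_nonneg)
      qed
      note mult = this
      \<comment> \<open>The rule is applied to the positive and the negative part of
        \<open>g L\<close>. As \<open>enn2real\<close> is multiplicative even at infinity,
        \<open>e\<close> then comes out of their difference.\<close>
      have "(\<lambda>\<omega>. - g L \<omega>) \<in> borel_measurable M" by measurable
      from mult[OF g[OF L]] mult[OF this]
      have "AE \<omega> in M. real_cond_exp M (F t) (\<lambda>\<omega>. e \<omega> * g L \<omega>) \<omega> = e \<omega> * v L \<omega>"
        by eventually_elim
          (simp add: real_cond_exp_def v_def enn2real_mult e_nonneg right_diff_distrib)
      moreover have "AE \<omega> in M. 0 < d \<omega>" using d by (simp add: L0pos_def)
      ultimately show ?thesis
        unfolding eq
      proof eventually_elim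
        case (elim \<omega>)
        have "e \<omega> * \<bar>v L \<omega>\<bar> \<le> d \<omega>"
        proof -
          have "\<bar>v L \<omega>\<bar> \<le> (\<Sum>L\<in>\<A>. \<bar>v L \<omega>\<bar>)"
            using fin L by (intro member_le_sum) auto
          then have "\<bar>v L \<omega>\<bar> / (1 + (\<Sum>L\<in>\<A>. \<bar>v L \<omega>\<bar>)) \<le> 1"
            by (intro divide_le_eq_1_pos[THEN iffD2]) auto
          from mult_left_mono[OF this, of "d \<omega>"] elim(2) show ?thesis
            by (simp add: e_def)
        qed
        then show ?case using e_nonneg elim(1) by (simp add: abs_mult)
      qed
    qed
    then have "const_on {t..T} e \<in> U"
      unfolding U using const_on_LtpO[OF e_meas] by blast
    with e that show thesis by blast
  next
    case False
    then obtain d where d: "d \<in> L0pos t"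
      and U: "U = {X \<in> LtpO p t. AE \<omega> in M. cond_norm t X \<omega> \<le> d \<omega>}"
      using U unfolding nhds_zero_def by auto
    let ?r = "enn2real p"
    have "1 \<le> ?r"
      using p_ge_1 False enn2real_mono[of 1 p] by (simp add: less_top)
    then have r: "0 < ?r" by linarith
    define m where "m = (\<Sum>k=t..T. \<mu> t k)"
    have m: "0 < m" unfolding m_def using assms(1) \<mu>_pos by (intro sum_pos) auto
    \<comment> \<open>The constant process \<open>e\<close> has conditional norm
      \<open>\<bar>e \<omega>\<bar> * m powr (1 / ?r)\<close>, with \<open>m\<close> the total mass
      of the times. This choice makes the norm equal to \<open>d\<close> almost surely.\<close>
    define e where "e \<omega> = \<bar>d \<omega>\<bar> / m powr (1 / ?r)" for \<omega>
    have [measurable]: "d \<in> borel_measurable (F t)" using d by (simp add: L0pos_def)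
    have e_meas [measurable]: "e \<in> borel_measurable (F t)" unfolding e_def by measurable
    have "AE \<omega> in M. 0 < e \<omega>"
      using d m unfolding L0pos_def by (auto simp: e_def elim!: eventually_mono)
    then have e: "e \<in> L0pos t" by (simp add: L0pos_def e_meas)
    have eq: "(\<Sum>k=t..T. \<bar>const_on {t..T} e k \<omega>\<bar> powr ?r * \<mu> t k) = \<bar>e \<omega>\<bar> powr ?r * m" for \<omega>
      by (simp add: on_times_def m_def sum_distrib_left)
    have "AE \<omega> in M. ennreal (\<bar>e \<omega>\<bar> powr ?r * m)
        = nn_cond_exp M (F t) (\<lambda>\<omega>. ennreal (\<bar>e \<omega>\<bar> powr ?r * m)) \<omega>"
      by (rule nn_cond_exp_F_meas) measurable
    moreover have "AE \<omega> in M. 0 < d \<omega>" using d by (simp add: L0pos_def)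
    ultimately have "AE \<omega> in M. cond_norm t (const_on {t..T} e) \<omega> \<le> d \<omega>"
    proof eventually_elim
      case (elim \<omega>)
      have "cond_norm t (const_on {t..T} e) \<omega> = (\<bar>e \<omega>\<bar> powr ?r * m) powr (1 / ?r)"
        unfolding cond_norm_def eq elim(1)[symmetric] using m by simp
      also have "\<dots> = \<bar>e \<omega>\<bar> * m powr (1 / ?r)"
        using m r by (simp add: powr_mult powr_powr)
      also have "\<dots> = d \<omega>" using m elim(2) by (simp add: e_def)
      finally show ?case by simp
    qed
    then have "const_on {t..T} e \<in> U"
      unfolding U using const_on_LtpO[OF e_meas] by blast
    with e that show thesis by blast
  qed
qed

text \<open>If the constant \<open>c\<close> were outside \<open>K\<close>, a whole neighbourhood of
  it would miss \<open>K\<close>. That neighbourhood contains some \<open>c + e\<close> with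
  \<open>e\<close> strictly positive, which lies in \<open>K\<close> by assumption.\<close>

lemma closedin_const_limit:
  assumes "t \<le> T" and K: "closedin (Ltp_topology t) K" and c: "c \<in> borel_measurable (F t)"
    and lim: "\<And>e. e \<in> L0pos t \<Longrightarrow> const_on {t..T} (\<lambda>\<omega>. c \<omega> + e \<omega>) \<in> K"
  shows "const_on {t..T} c \<in> K"
proof (rule ccontr)
  assume "const_on {t..T} c \<notin> K"
  moreover have "is_open_Ltp t (LtpO p t - K)"
    using K by (simp add: closedin_def topspace_Ltp_topology openin_Ltp_topology)
  ultimately obtain U where U: "U \<in> nhds_zero t"
    "{Y \<in> LtpO p t. Y - const_on {t..T} c \<in> U} \<subseteq> LtpO p t - K"
    using const_on_LtpO[OF c] unfolding is_open_Ltp_def by blast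
  obtain e where e: "e \<in> L0pos t" "const_on {t..T} e \<in> U"
    using nhds_zero_const[OF assms(1) U(1)] .
  have "const_on {t..T} (\<lambda>\<omega>. c \<omega> + e \<omega>) - const_on {t..T} c = const_on {t..T} e"
    by (auto simp: fun_eq_iff on_times_def fun_diff_def)
  moreover have "const_on {t..T} (\<lambda>\<omega>. c \<omega> + e \<omega>) \<in> LtpO p t"
    using c e(1) by (intro const_on_LtpO) (auto simp: L0pos_def)
  ultimately have "const_on {t..T} (\<lambda>\<omega>. c \<omega> + e \<omega>) \<notin> K"
    using U(2) e(2) by auto
  with lim[OF e(1)] show False by blast
qed

section \<open>Certainty equivalents\<close>

text \<open>The properties of the index are stated for pasts frozen from \<open>t - 1\<close> on.
  Stopping an adapted process there gives such a past, so they apply to the history of any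
  \<open>X\<close>. For \<open>t = 0\<close> the stopped process is \<open>X 0\<close> throughout
  and both restrictions vanish.\<close>

lemma pasts_extension:
  assumes "X \<in> adapted"
  obtains Y where "Y \<in> pasts t" "on_times {..<t} Y = on_times {..<t} X"
proof
  define Y where "Y k = X (min k (t - 1))" for k
  have "Y k \<in> borel_measurable (F k)" if "k \<le> T" for k
    unfolding Y_def using assms that
    by (intro F_mono[of "min k (t - 1)" k]) (auto simp: adapted_def)
  moreover have "Y s = Y (t - 1)" if "s \<in> {t..T}" for s
    using that by (auto simp: Y_def intro!: arg_cong[of _ _ X])
  ultimately show "Y \<in> pasts t"
    by (simp add: pasts_def adapted_def)
  show "on_times {..<t} Y = on_times {..<t} X"
    by (auto simp: on_times_def Y_def fun_eq_iff min_def)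
qed

lemma usc_assessment_indexD:
  assumes "usc_assessment_index t a" "X \<in> adapted"
  shows "local_map t (\<lambda>Z. a (on_times {..<t} X + Z))"
    and "monotone_map t (\<lambda>Z. a (on_times {..<t} X + Z))"
    and "upper_semicontinuous_map t (\<lambda>Z. a (on_times {..<t} X + Z))"
proof -
  obtain Y where "Y \<in> pasts t" "on_times {..<t} Y = on_times {..<t} X"
    using pasts_extension[OF assms(2)] .
  then show "local_map t (\<lambda>Z. a (on_times {..<t} X + Z))"
    "monotone_map t (\<lambda>Z. a (on_times {..<t} X + Z))"
    "upper_semicontinuous_map t (\<lambda>Z. a (on_times {..<t} X + Z))"
    using assms(1) unfolding usc_assessment_index_def Let_def by metis+
qed

lemma bounded_sensitive_increasingD:
  assumes "bounded_sensitive_increasing \<alpha>" "t \<le> T" "X \<in> adapted"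
  shows "bounded_map t (\<lambda>Z. \<alpha> t (on_times {..<t} X + Z))"
    and "sensitive_map t (\<lambda>Z. \<alpha> t (on_times {..<t} X + Z))"
    and "strictly_increasing_map t (\<lambda>Z. \<alpha> t (on_times {..<t} X + Z))"
proof -
  obtain Y where "Y \<in> pasts t" "on_times {..<t} Y = on_times {..<t} X"
    using pasts_extension[OF assms(3)] .
  then show "bounded_map t (\<lambda>Z. \<alpha> t (on_times {..<t} X + Z))"
    "sensitive_map t (\<lambda>Z. \<alpha> t (on_times {..<t} X + Z))"
    "strictly_increasing_map t (\<lambda>Z. \<alpha> t (on_times {..<t} X + Z))"
    using assms(1,2) unfolding bounded_sensitive_increasing_def Let_def by metis+
qed

lemma local_mapD_const:
  assumes "local_map t b" "m \<in> borel_measurable (F t)" "m' \<in> borel_measurable (F t)"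
    "A \<in> sets (F t)"
  shows "AE \<omega> in M. b (const_on {t..T} (\<lambda>\<omega>. if \<omega> \<in> A then m \<omega> else m' \<omega>)) \<omega>
    = (if \<omega> \<in> A then b (const_on {t..T} m) \<omega> else b (const_on {t..T} m') \<omega>)"
proof -
  have "const_on {t..T} (\<lambda>\<omega>. if \<omega> \<in> A then m \<omega> else m' \<omega>)
    = (\<lambda>k \<omega>. if \<omega> \<in> A then const_on {t..T} m k \<omega> else const_on {t..T} m' k \<omega>)"
    by (auto simp: on_times_def fun_eq_iff)
  then show ?thesis
    using assms const_on_LtpO unfolding local_map_def by simp
qed

lemma monotone_mapD_const:
  assumes "monotone_map t b" "m \<in> borel_measurable (F t)" "m' \<in> borel_measurable (F t)"
    "AE \<omega> in M. m \<omega> \<le> m' \<omega>"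
  shows "AE \<omega> in M. b (const_on {t..T} m) \<omega> \<le> b (const_on {t..T} m') \<omega>"
  using assms const_on_LtpO unfolding monotone_map_def
  by (auto simp: on_times_def)

lemma certainty_equivalent_properties:
  assumes usc: "usc_assessment_index t (\<alpha> t)" and bsi: "bounded_sensitive_increasing \<alpha>"
    and t: "t \<le> T" and X: "X \<in> XX t"
  defines "c \<equiv> (\<lambda>\<omega>. real_of_ereal (certainty_equivalent \<alpha> t X \<omega>))"
  shows "c \<in> LpF t"
    and "AE \<omega> in M. \<alpha> t (on_times {..<t} X + const_on {t..T} c) \<omega> = \<alpha> t X \<omega>"
proof -
  interpret G: finite_measure_subalgebra M "F t" using t by (rule finite_measure_subalgebra_F)
  have space_F: "space (F t) = space M" using subalg[OF t] by (simp add: subalgebra_def)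
  define b where "b Z = \<alpha> t (on_times {..<t} X + Z)" for Z
  define K where "K m = const_on {t..T} m" for m :: "'a \<Rightarrow> real"
  define S where "S = {m \<in> LpF t. AE \<omega> in M. b (K m) \<omega> \<ge> \<alpha> t X \<omega>}"
  have ad: "X \<in> adapted" and Z: "on_times {t..T} X \<in> LtpO p t" using X by (auto simp: XX_def)
  note usc_props = usc_assessment_indexD[OF usc ad, folded b_def]
  note bsi_props = bounded_sensitive_increasingD[OF bsi t ad, folded b_def]
  have K: "K m \<in> LtpO p t" if "m \<in> borel_measurable (F t)" for m
    unfolding K_def using that by (rule const_on_LtpO)
  have \<alpha>_meas [measurable]: "\<alpha> t X \<in> borel_measurable (F t)"
    using usc X by (auto simp: usc_assessment_index_def)
  have b_meas: "b Z \<in> borel_measurable (F t)" if "Z \<in> LtpO p t" for Z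
    using usc LtpO_in_XX[OF ad that] by (auto simp: usc_assessment_index_def b_def)
  \<comment> \<open>The two pieces recover \<open>X\<close> only up to time \<open>T\<close>.
    Invariance of the index under almost sure equality at those times closes the gap.\<close>
  have bX: "AE \<omega> in M. b (on_times {t..T} X) \<omega> = \<alpha> t X \<omega>"
  proof -
    have "(on_times {..<t} X + on_times {t..T} X) s = X s" if "s \<le> T" for s
      using that by (auto simp: on_times_def fun_eq_iff)
    then show ?thesis
      using usc X LtpO_in_XX[OF ad Z] unfolding usc_assessment_index_def b_def by auto
  qed
  obtain m1 m2 where m1: "m1 \<in> LpF t" "AE \<omega> in M. b (K m1) \<omega> < b (on_times {t..T} X) \<omega>"
    and m2: "m2 \<in> LpF t" "AE \<omega> in M. b (on_times {t..T} X) \<omega> \<le> b (K m2) \<omega>"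
    using bsi_props(1) Z unfolding bounded_map_def K_def by blast
  have [measurable]: "m1 \<in> borel_measurable (F t)" "m2 \<in> borel_measurable (F t)"
    using m1 m2 by (auto simp: LpF_def)
  have "AE \<omega> in M. \<alpha> t X \<omega> \<le> b (K m2) \<omega>"
    using m2(2) bX by eventually_elim simp
  then have m2_S: "m2 \<in> S" using m2(1) by (simp add: S_def)
  \<comment> \<open>On the set \<open>A\<close> where \<open>m\<close> falls below
    \<open>m1\<close>, strict increase puts the value of \<open>m\<close> below that of
    \<open>m1\<close>, hence below that of \<open>X\<close>. This contradicts admissibility unless
    \<open>A\<close> is null.\<close>
  have m1_le: "AE \<omega> in M. m1 \<omega> \<le> m \<omega>" if m: "m \<in> S" for m
  proof -
    have [measurable]: "m \<in> borel_measurable (F t)" using m by (simp add: S_def LpF_def)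
    define A where "A = {\<omega> \<in> space (F t). m \<omega> < m1 \<omega>}"
    have "A \<in> sets (F t)" unfolding A_def by measurable
    moreover have "AE \<omega> in M. \<omega> \<in> A \<longrightarrow> m \<omega> < m1 \<omega>" by (simp add: A_def)
    ultimately have "AE \<omega> in M. \<omega> \<in> A \<longrightarrow> b (K m) \<omega> < b (K m1) \<omega>"
      using bsi_props(3) unfolding strictly_increasing_map_def K_def by simp
    moreover have "AE \<omega> in M. \<alpha> t X \<omega> \<le> b (K m) \<omega>" using m by (simp add: S_def)
    ultimately show ?thesis
      using m1(2) bX AE_space
    proof eventually_elim
      case (elim \<omega>)
      then have "\<omega> \<notin> A" by auto
      with elim(5) show ?case by (simp add: A_def space_F)
    qed
  qed
  have "S \<subseteq> borel_measurable (F t)" by (auto simp: S_def LpF_def)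
  then obtain s :: "nat \<Rightarrow> 'a \<Rightarrow> real"
    where s: "range s \<subseteq> S" "is_ess_inf M (F t) S (\<lambda>\<omega>. INF n. ereal (s n \<omega>))"
    by (rule ess_inf_eq_INF[OF subalg[OF t]]) (use m2_S in auto)
  define C where "C = certainty_equivalent \<alpha> t X"
  have "C = ess_inf M (F t) S"
    by (simp add: C_def certainty_equivalent_def S_def b_def K_def)
  \<comment> \<open>The infimum along \<open>s\<close> shows that an essential infimum exists, so
    the version picked by choice is one too; by uniqueness both agree almost surely.\<close>
  then have C: "is_ess_inf M (F t) S C"
    using s(2) unfolding ess_inf_def by (metis someI)
  then have C_meas [measurable]: "C \<in> borel_measurable (F t)" by (simp add: is_ess_inf_def)
  then have c_meas [measurable]: "c \<in> borel_measurable (F t)"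
    unfolding c_def C_def[symmetric] by measurable
  have C_INF: "AE \<omega> in M. C \<omega> = (INF n. ereal (s n \<omega>))"
    using C s(2) by (rule is_ess_inf_unique)
  have lower: "AE \<omega> in M. ereal (m1 \<omega>) \<le> C \<omega>"
    using C m1_le unfolding is_ess_inf_def by simp
  have upper: "AE \<omega> in M. C \<omega> \<le> ereal (m \<omega>)" if "m \<in> S" for m
    using C that unfolding is_ess_inf_def by blast
  \<comment> \<open>The bounds \<open>m1\<close> and \<open>m2\<close> make \<open>C\<close> almost
    surely finite, so passing to \<open>real_of_ereal\<close> changes it only on a null set.\<close>
  have Cc: "AE \<omega> in M. C \<omega> = ereal (c \<omega>)"
    using lower upper[OF m2_S]
  proof eventually_elim
    case (elim \<omega>)
    then show ?case by (cases "C \<omega>") (auto simp: c_def C_def[symmetric])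
  qed
  show c: "c \<in> LpF t"
  proof -
    have "AE \<omega> in M. \<bar>c \<omega>\<bar> \<le> \<bar>m1 \<omega>\<bar> + \<bar>m2 \<omega>\<bar>"
      using lower upper[OF m2_S] Cc by eventually_elim auto
    then show ?thesis
      using Lp_dominated[OF F_measurable[OF t c_meas], of m1 p m2] m1(1) m2(1) c_meas
      by (simp add: LpF_def)
  qed

  have c_ge: "AE \<omega> in M. \<alpha> t X \<omega> \<le> b (K c) \<omega>"
  proof -
    define L where "L = {Z \<in> LtpO p t. AE \<omega> in M. b Z \<omega> \<ge> \<alpha> t X \<omega>}"
    have "K c \<in> L"
      unfolding K_def
    proof (rule closedin_const_limit[OF t _ c_meas])
      show "closedin (Ltp_topology t) L"
        using usc_props(3) unfolding upper_semicontinuous_map_def L_def by simp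
      fix e assume e: "e \<in> L0pos t"
      define d where "d \<omega> = c \<omega> + e \<omega>" for \<omega>
      have [measurable]: "e \<in> borel_measurable (F t)" using e by (simp add: L0pos_def)
      have d_meas [measurable]: "d \<in> borel_measurable (F t)" unfolding d_def by measurable
      \<comment> \<open>No single \<open>s n\<close> need lie below \<open>d\<close> everywhere, so
        it is pasted with \<open>d\<close>: \<open>u\<close> is \<open>s n\<close> where that is
        smaller and \<open>d\<close> elsewhere. Locality gives \<open>u\<close> the value of
        \<open>s n\<close> on the first set, and monotonicity passes this bound on to
        \<open>d\<close>.\<close>
      have near: "AE \<omega> in M. s n \<omega> < d \<omega> \<longrightarrow> \<alpha> t X \<omega> \<le> b (K d) \<omega>" for n
      proof -
        have sn: "s n \<in> S" using s(1) by blast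
        then have [measurable]: "s n \<in> borel_measurable (F t)" by (simp add: S_def LpF_def)
        define A where "A = {\<omega> \<in> space (F t). s n \<omega> < d \<omega>}"
        have A: "A \<in> sets (F t)" unfolding A_def by measurable
        define u where "u \<omega> = (if \<omega> \<in> A then s n \<omega> else d \<omega>)" for \<omega>
        have u_meas: "u \<in> borel_measurable (F t)" unfolding u_def using A by measurable
        have "AE \<omega> in M. b (K u) \<omega> = (if \<omega> \<in> A then b (K (s n)) \<omega> else b (K d) \<omega>)"
          unfolding K_def u_def by (rule local_mapD_const[OF usc_props(1) _ _ A]) measurable
        moreover have "AE \<omega> in M. b (K u) \<omega> \<le> b (K d) \<omega>"
          unfolding K_def
          by (rule monotone_mapD_const[OF usc_props(2) u_meas d_meas]) (simp add: u_def A_def)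
        moreover have "AE \<omega> in M. \<alpha> t X \<omega> \<le> b (K (s n)) \<omega>" using sn by (simp add: S_def)
        ultimately show ?thesis
          using AE_space
          by eventually_elim (auto simp: A_def space_F)
      qed
      then have "AE \<omega> in M. \<forall>n. s n \<omega> < d \<omega> \<longrightarrow> \<alpha> t X \<omega> \<le> b (K d) \<omega>"
        unfolding AE_all_countable ..
      moreover have "AE \<omega> in M. 0 < e \<omega>" using e by (simp add: L0pos_def)
      ultimately have "AE \<omega> in M. \<alpha> t X \<omega> \<le> b (K d) \<omega>"
        using C_INF Cc
      proof eventually_elim
        \<comment> \<open>The index \<open>n\<close> found here depends on \<open>\<omega>\<close>;
          for this reason the exceptional null sets were first united over all
          \<open>n\<close>.\<close>
        case (elim \<omega>)
        have "(INF n. ereal (s n \<omega>)) = ereal (c \<omega>)" using elim by metis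
        also have "\<dots> < ereal (d \<omega>)" using elim(2) by (simp add: d_def)
        finally have "(INF n. ereal (s n \<omega>)) < ereal (d \<omega>)" .
        then obtain n where "s n \<omega> < d \<omega>" by (auto simp: INF_less_iff)
        with elim(1) show ?case by blast
      qed
      then have "K d \<in> L" using K[OF d_meas] by (simp add: L_def)
      then show "const_on {t..T} (\<lambda>\<omega>. c \<omega> + e \<omega>) \<in> L" by (simp add: K_def d_def[abs_def])
    qed
    then show ?thesis by (simp add: L_def)
  qed

  have c_le: "AE \<omega> in M. b (K c) \<omega> \<le> \<alpha> t X \<omega>"
  proof -
    have [measurable]: "b (K c) \<in> borel_measurable (F t)" by (rule b_meas[OF K[OF c_meas]])
    define A where "A = {\<omega> \<in> space (F t). \<alpha> t X \<omega> < b (K c) \<omega>}"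
    have A: "A \<in> sets (F t)" unfolding A_def by measurable
    have "AE \<omega> in M. \<omega> \<in> A \<longrightarrow> b (on_times {t..T} X) \<omega> < b (K c) \<omega>"
      using bX by eventually_elim (simp add: A_def)
    then obtain e where e_meas [measurable]: "e \<in> borel_measurable (F t)"
      and e: "AE \<omega> in M. 0 \<le> e \<omega>" "AE \<omega> in M. \<omega> \<in> A \<longrightarrow> 0 < e \<omega>"
      and b_e: "AE \<omega> in M. \<omega> \<in> A \<longrightarrow> b (on_times {t..T} X) \<omega> \<le> b (K (\<lambda>\<omega>. c \<omega> - e \<omega>)) \<omega>"
      using bsi_props(2) Z A c_meas unfolding sensitive_map_def K_def by blast
    \<comment> \<open>Sensitivity only provides a measurable \<open>e\<close>. Truncation at 1 keeps
      the lowered constant in L^p, and since it lowers \<open>c\<close> by no more than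
      \<open>e\<close>, monotonicity preserves the inequality.\<close>
    define d where "d \<omega> = c \<omega> - min (e \<omega>) 1" for \<omega>
    have d_meas [measurable]: "d \<in> borel_measurable (F t)" unfolding d_def by measurable
    \<comment> \<open>Off \<open>A\<close> the constant \<open>c\<close> is kept, which is
      admissible there by \<open>c_ge\<close>; locality joins the two parts.\<close>
    define m where "m \<omega> = (if \<omega> \<in> A then d \<omega> else c \<omega>)" for \<omega>
    have m_meas: "m \<in> borel_measurable (F t)" unfolding m_def using A by measurable
    have "AE \<omega> in M. b (K m) \<omega> = (if \<omega> \<in> A then b (K d) \<omega> else b (K c) \<omega>)"
      unfolding K_def m_def by (rule local_mapD_const[OF usc_props(1) d_meas c_meas A])
    moreover have "AE \<omega> in M. b (K (\<lambda>\<omega>. c \<omega> - e \<omega>)) \<omega> \<le> b (K d) \<omega>"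
      unfolding K_def by (rule monotone_mapD_const[OF usc_props(2) _ d_meas]) (auto simp: d_def)
    ultimately have "AE \<omega> in M. \<alpha> t X \<omega> \<le> b (K m) \<omega>"
      using b_e bX c_ge
      by eventually_elim auto
    moreover have "m \<in> LpF t"
    proof -
      have "AE \<omega> in M. \<bar>m \<omega>\<bar> \<le> \<bar>c \<omega>\<bar> + \<bar>1\<bar>"
        using e(1) by eventually_elim (auto simp: m_def d_def)
      then show ?thesis
        using Lp_dominated[OF F_measurable[OF t m_meas], of c p "\<lambda>_. 1"] c const_in_Lp m_meas
        by (simp add: LpF_def)
    qed
    ultimately have "AE \<omega> in M. C \<omega> \<le> ereal (m \<omega>)"
      by (intro upper) (simp add: S_def)
    then show ?thesis
      using Cc e(2) AE_space
    proof eventually_elim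
      case (elim \<omega>)
      \<comment> \<open>On \<open>A\<close> the admissible \<open>m\<close> lies strictly below
        \<open>c\<close>, which is the essential infimum; so \<open>A\<close> is null.\<close>
      then have "\<omega> \<notin> A" by (auto simp: m_def d_def)
      with elim(4) show ?case by (simp add: A_def space_F not_less)
    qed
  qed

  show "AE \<omega> in M. \<alpha> t (on_times {..<t} X + const_on {t..T} c) \<omega> = \<alpha> t X \<omega>"
    using c_ge c_le unfolding b_def K_def by eventually_elim simp
qed

text \<open>The future of a process enters the defining set only through the threshold, up to null
  sets. The sets therefore coincide, and with them the chosen versions, so equality holds
  everywhere.\<close>

lemma certainty_equivalent_cong:
  assumes "on_times {..<t} X = on_times {..<t} Y" "AE \<omega> in M. \<alpha> t X \<omega> = \<alpha> t Y \<omega>"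
  shows "certainty_equivalent \<alpha> t X = certainty_equivalent \<alpha> t Y"
proof -
  have "(AE \<omega> in M. f \<omega> \<ge> \<alpha> t X \<omega>) \<longleftrightarrow> (AE \<omega> in M. f \<omega> \<ge> \<alpha> t Y \<omega>)" for f
    using assms(2) by (intro eventually_subst) (auto elim: eventually_mono)
  then show ?thesis by (simp add: certainty_equivalent_def assms(1))
qed

end

section \<open>The recursion for certainty equivalents\<close>

theorem proposition4p3:
  fixes M :: "'a measure" and F :: "nat \<Rightarrow> 'a measure" and T :: nat
    and p :: ennreal and \<mu> :: "nat \<Rightarrow> nat \<Rightarrow> real"
    and \<alpha> :: "nat \<Rightarrow> (nat \<Rightarrow> 'a \<Rightarrow> real) \<Rightarrow> 'a \<Rightarrow> ereal"
    and C :: "nat \<Rightarrow> (nat \<Rightarrow> 'a \<Rightarrow> real) \<Rightarrow> 'a \<Rightarrow> ereal"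
  defines "C \<equiv> filtered_setting.certainty_equivalent M F T p \<alpha>"
  assumes "filtered_setting M F T p \<mu>"
    and "filtered_setting.dynamic_assessment_index M F T p \<mu> \<alpha>"
    and "filtered_setting.bounded_sensitive_increasing M F T p \<mu> \<alpha>"
    and "filtered_setting.strongly_time_consistent M F T p \<mu> \<alpha>"
  shows "\<forall>t<T. \<forall>X\<in>filtered_setting.XX M F T p \<mu> t. AE \<omega> in M.
    C t X \<omega> =
    C t (on_times {..t} X + const_on {t + 1..T} (\<lambda>\<omega>. real_of_ereal (C (t + 1) X \<omega>))) \<omega>"
proof (intro allI impI ballI)
  interpret filtered_setting M F T p \<mu> by fact
  fix t X assume t: "t < T" and X: "X \<in> XX t"
  define c where "c = (\<lambda>\<omega>. real_of_ereal (certainty_equivalent \<alpha> (t + 1) X \<omega>))"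
  define Y where "Y = on_times {..t} X + const_on {t + 1..T} c"
  have X': "X \<in> XX (t + 1)" using XX_mono[of t "t + 1"] X t by auto
  have usc: "usc_assessment_index (t + 1) (\<alpha> (t + 1))"
    using assms(3) t by (simp add: dynamic_assessment_index_def)
  \<comment> \<open>The strict past of time \<open>t + 1\<close> is the past up to and including
    \<open>t\<close>, so attainment of the certainty equivalent at \<open>t + 1\<close> is a
    statement about \<open>Y\<close>.\<close>
  have "{..<t + 1} = {..t}" by auto
  with certainty_equivalent_properties[OF usc assms(4) _ X'] t
  have c: "c \<in> LpF (t + 1)" and eq: "AE \<omega> in M. \<alpha> (t + 1) Y \<omega> = \<alpha> (t + 1) X \<omega>"
    by (simp_all add: c_def Y_def)
  \<comment> \<open>Consistency compares processes in the domain at time \<open>t\<close>, which is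
    smaller than the one at \<open>t + 1\<close>; this is where \<open>c\<close> being in L^p is
    used.\<close>
  have Y: "Y \<in> XX t"
    unfolding Y_def using X c t by (intro const_continuation_in_XX) (auto simp: XX_def)
  have past: "X s \<omega> = Y s \<omega>" if "s \<le> t" for s \<omega>
    using that by (simp add: Y_def on_times_def)
  have "AE \<omega> in M. \<alpha> (t + 1) X \<omega> \<ge> \<alpha> (t + 1) Y \<omega>" "AE \<omega> in M. \<alpha> (t + 1) Y \<omega> \<ge> \<alpha> (t + 1) X \<omega>"
    using eq by (eventually_elim, simp)+
  then have "AE \<omega> in M. \<alpha> t X \<omega> \<ge> \<alpha> t Y \<omega>" "AE \<omega> in M. \<alpha> t Y \<omega> \<ge> \<alpha> t X \<omega>"
    using assms(5) t X Y past unfolding strongly_time_consistent_def by simp_all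
  then have "AE \<omega> in M. \<alpha> t X \<omega> = \<alpha> t Y \<omega>"
    by eventually_elim simp
  moreover have "on_times {..<t} X = on_times {..<t} Y"
    using past by (auto simp: on_times_def fun_eq_iff)
  ultimately have "certainty_equivalent \<alpha> t X = certainty_equivalent \<alpha> t Y"
    by (intro certainty_equivalent_cong)
  then show "AE \<omega> in M. C t X \<omega> =
      C t (on_times {..t} X + const_on {t + 1..T} (\<lambda>\<omega>. real_of_ereal (C (t + 1) X \<omega>))) \<omega>"
    by (simp add: C_def Y_def c_def)
qed

end
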